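(* Let $n$ be a positive integer, $\{R_i\}_{i=1}^n$ a set of unital rings and $\theta_i:R_1\to R_i$ ring isomorphisms, $i\in\mathbb{I}_n=\{1,\dots,n\}$. Put $\theta_{ij}=\theta_j\theta_i^{-1}:R_i\to R_j$. Let $\mathcal{G}=\mathbb{I}_n\times\mathbb{I}_n$ be the groupoid with $(j,k)(i,j)=(i,k)$, let $A=\prod_{i\in\mathbb{I}_n}R_i$, and let $\theta=(A_u,\theta_u)_{u\in\mathcal{G}}$ be the action of $\mathcal{G}$ on $A$ given by $A_{(i,j)}=R_j$, $\theta_{(i,j)}=\theta_{ij}:R_i\to R_j$. Then the skew groupoid ring $A*_{\theta}\mathcal{G}$ is isomorphic (as a ring) to the $n$-by-$n$ generalized matrix ring $$R=\begin{pmatrix} R_1\delta_{(1,1)} & R_1\delta_{(2,1)} & \cdots & R_1\delta_{(n,1)}\\ R_2\delta_{(1,2)} & R_2\delta_{(2,2)} & \cdots & R_2\delta_{(n,2)}\\ \vdots & \vdots & \ddots & \vdots\\ R_n\delta_{(1,n)} & R_n\delta_{(2,n)} & \cdots & R_n\delta_{(n,n)}\end{pmatrix},$$ that is, $R=(M_{ij})_{i,j\in\mathbb{I}_n}$ with $M_{ij}=R_i\delta_{(j,i)}$ and products of entries given by $(r\delta_{(j,i)})(s\delta_{(k,j)})=r\,\theta_{ij}^{-1}(s)\,\delta_{(k,i)}$ for $r\in R_i$, $s\in R_j$.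
   Context: The groupoid $\mathcal{G}=\mathbb{I}_n\times\mathbb{I}_n$ has objects $(i,i)$, source $s(i,j)=(i,i)$ and target $t(i,j)=(j,j)$. The skew groupoid ring is $A*_{\theta}\mathcal{G}=\oplus_{i,j\in\mathbb{I}_n}R_j\delta_{(i,j)}$ (the $\delta_{(i,j)}$ are symbols), with componentwise sum and multiplication $(a\delta_{(k,l)})(b\delta_{(i,j)})=a\,\theta_{jl}(b)\,\delta_{(i,l)}$ if $j=k$, and $0$ otherwise. An $n$-by-$n$ generalized matrix ring $(M_{ij})_{i,j\in\mathbb{I}_n}$ is given by rings $M_{ii}$, $(M_{ii},M_{jj})$-bimodules $M_{ij}$, and bimodule morphisms $M_{ij}\otimes_{M_{jj}}M_{jk}\to M_{ik}$ (written as products, extending the ring multiplications and bimodule actions) satisfying $(m_{ij}m_{jk})m_{kl}=m_{ij}(m_{jk}m_{kl})$; its elements are arrays $(m_{ij})$ with $m_{ij}\in M_{ij}$, with componentwise addition and row-column multiplication. In $R$, the bimodule structure of $M_{ij}=R_i\delta_{(j,i)}$ over $(R_i\delta_{(i,i)},R_j\delta_{(j,j)})$ is $r\delta_{(i,i)}\cdot s\delta_{(j,i)}=rs\,\delta_{(j,i)}$ and $s\delta_{(j,i)}\cdot t\delta_{(j,j)}=s\,\theta_{ij}^{-1}(t)\,\delta_{(j,i)}$, $r,s\in R_i$, $t\in R_j$. *)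

theory Defs
  imports "HOL-Algebra.QuotRing"
begin

section \<open>Groupoids and their actions on rings\<close>

text \<open>A groupoid is given by its morphisms; an object is identified with its identity morphism, so
  source and target are again morphisms. The product \<open>cmp G u v\<close> stands for ``first \<open>v\<close>, then \<open>u\<close>''
  and is only meaningful when the source of \<open>u\<close> is the target of \<open>v\<close>.\<close>

record 'g groupoid_data =
  arr :: "'g set"
  src :: "'g \<Rightarrow> 'g"
  tgt :: "'g \<Rightarrow> 'g"
  cmp :: "'g \<Rightarrow> 'g \<Rightarrow> 'g"

definition objects :: "('g, 'x) groupoid_data_scheme \<Rightarrow> 'g set" where
  "objects G = src G ` arr G \<union> tgt G ` arr G"

locale groupoid =
  fixes G :: "('g, 'x) groupoid_data_scheme"
  assumes objects_closed: "objects G \<subseteq> arr G"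
    and src_object: "e \<in> objects G \<Longrightarrow> src G e = e"
    and tgt_object: "e \<in> objects G \<Longrightarrow> tgt G e = e"
    and cmp_closed: "\<lbrakk>u \<in> arr G; v \<in> arr G; src G u = tgt G v\<rbrakk> \<Longrightarrow> cmp G u v \<in> arr G"
    and src_cmp: "\<lbrakk>u \<in> arr G; v \<in> arr G; src G u = tgt G v\<rbrakk> \<Longrightarrow> src G (cmp G u v) = src G v"
    and tgt_cmp: "\<lbrakk>u \<in> arr G; v \<in> arr G; src G u = tgt G v\<rbrakk> \<Longrightarrow> tgt G (cmp G u v) = tgt G u"
    and cmp_assoc: "\<lbrakk>u \<in> arr G; v \<in> arr G; w \<in> arr G; src G u = tgt G v; src G v = tgt G w\<rbrakk>
          \<Longrightarrow> cmp G (cmp G u v) w = cmp G u (cmp G v w)"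
    and cmp_src: "u \<in> arr G \<Longrightarrow> cmp G u (src G u) = u"
    and tgt_cmp_left: "u \<in> arr G \<Longrightarrow> cmp G (tgt G u) u = u"
    and inverse_exists: "u \<in> arr G \<Longrightarrow>
          \<exists>v\<in>arr G. src G v = tgt G u \<and> tgt G v = src G u \<and>
            cmp G v u = src G u \<and> cmp G u v = tgt G u"

text \<open>An action consists of ideals \<open>I u\<close> of \<open>A\<close> that depend only on the target of \<open>u\<close>, and of
  ring isomorphisms \<open>\<phi> u\<close> from \<open>I (src u)\<close> to \<open>I u\<close>. The ideals are rings that need not contain
  the unit of \<open>A\<close>, so \<open>ring_iso\<close> does not apply to them.\<close>

locale groupoid_action = groupoid G + ring A
  for G :: "('g, 'x) groupoid_data_scheme" and A :: "('a, 'm) ring_scheme" +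
  fixes I :: "'g \<Rightarrow> 'a set" and \<phi> :: "'g \<Rightarrow> 'a \<Rightarrow> 'a"
  assumes ideal_I: "u \<in> arr G \<Longrightarrow> ideal (I u) A"
    and I_tgt: "u \<in> arr G \<Longrightarrow> I u = I (tgt G u)"
    and \<phi>_bij: "u \<in> arr G \<Longrightarrow> bij_betw (\<phi> u) (I (src G u)) (I u)"
    and \<phi>_add: "\<lbrakk>u \<in> arr G; a \<in> I (src G u); b \<in> I (src G u)\<rbrakk>
          \<Longrightarrow> \<phi> u (a \<oplus>\<^bsub>A\<^esub> b) = \<phi> u a \<oplus>\<^bsub>A\<^esub> \<phi> u b"
    and \<phi>_mult: "\<lbrakk>u \<in> arr G; a \<in> I (src G u); b \<in> I (src G u)\<rbrakk>
          \<Longrightarrow> \<phi> u (a \<otimes>\<^bsub>A\<^esub> b) = \<phi> u a \<otimes>\<^bsub>A\<^esub> \<phi> u b"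
    and \<phi>_object: "\<lbrakk>e \<in> objects G; a \<in> I e\<rbrakk> \<Longrightarrow> \<phi> e a = a"
    and \<phi>_cmp: "\<lbrakk>u \<in> arr G; v \<in> arr G; src G u = tgt G v; a \<in> I (src G v)\<rbrakk>
          \<Longrightarrow> \<phi> u (\<phi> v a) = \<phi> (cmp G u v) a"


section \<open>Skew groupoid rings\<close>

text \<open>The element \<open>\<Sum>\<^sub>u f(u) \<delta>\<^sub>u\<close> of the direct sum of the \<open>I u \<delta>\<^sub>u\<close> is represented by its coefficient
  function \<open>f\<close>. The product is the biadditive extension of
  \<open>(a \<delta>\<^sub>u) (b \<delta>\<^sub>v) = a (\<phi> u b) \<delta>\<^sub>u\<^sub>v\<close> if \<open>src u = tgt v\<close>, and \<open>0\<close> otherwise; it is summed over the supports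
  because \<open>finsum\<close> is only meaningful over finite sets. The unit is \<open>\<Sum>\<^sub>e 1\<^sub>e \<delta>\<^sub>e\<close> over the objects,
  with \<open>1\<^sub>e\<close> the unit of the ring \<open>I e\<close>; it is a unit when there are finitely many objects and each
  \<open>I e\<close> is unital.\<close>

definition ideal_unit :: "('a, 'm) ring_scheme \<Rightarrow> 'a set \<Rightarrow> 'a" where
  "ideal_unit A J = (THE e. e \<in> J \<and> (\<forall>a\<in>J. e \<otimes>\<^bsub>A\<^esub> a = a \<and> a \<otimes>\<^bsub>A\<^esub> e = a))"

definition supp :: "('g, 'x) groupoid_data_scheme \<Rightarrow> ('a, 'm) ring_scheme \<Rightarrow> ('g \<Rightarrow> 'a) \<Rightarrow> 'g set" where
  "supp G A f = {u \<in> arr G. f u \<noteq> \<zero>\<^bsub>A\<^esub>}"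

definition skew_groupoid_ring ::
  "('g, 'x) groupoid_data_scheme \<Rightarrow> ('a, 'm) ring_scheme \<Rightarrow> ('g \<Rightarrow> 'a set) \<Rightarrow> ('g \<Rightarrow> 'a \<Rightarrow> 'a)
    \<Rightarrow> ('g \<Rightarrow> 'a) ring" where
  "skew_groupoid_ring G A I \<phi> =
    \<lparr> carrier = {f \<in> (\<Pi>\<^sub>E u\<in>arr G. I u). finite (supp G A f)},
      mult = (\<lambda>f g. \<lambda>w\<in>arr G.
        finsum A (\<lambda>(u, v). f u \<otimes>\<^bsub>A\<^esub> \<phi> u (g v))
          {(u, v). u \<in> supp G A f \<and> v \<in> supp G A g \<and> src G u = tgt G v \<and> cmp G u v = w}),
      one = (\<lambda>w\<in>arr G. if w \<in> objects G then ideal_unit A (I w) else \<zero>\<^bsub>A\<^esub>),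
      zero = (\<lambda>w\<in>arr G. \<zero>\<^bsub>A\<^esub>),
      add = (\<lambda>f g. \<lambda>w\<in>arr G. f w \<oplus>\<^bsub>A\<^esub> g w) \<rparr>"


section \<open>Generalized matrix rings\<close>

locale bimodule = P: ring P + Q: ring Q + M: abelian_group M
  for P :: "('p, 'x) ring_scheme" and Q :: "('q, 'y) ring_scheme"
    and M :: "('m, 'z) ring_scheme" +
  fixes lact :: "'p \<Rightarrow> 'm \<Rightarrow> 'm" and ract :: "'m \<Rightarrow> 'q \<Rightarrow> 'm"
  assumes lact_closed: "\<lbrakk>p \<in> carrier P; x \<in> carrier M\<rbrakk> \<Longrightarrow> lact p x \<in> carrier M"
    and ract_closed: "\<lbrakk>x \<in> carrier M; q \<in> carrier Q\<rbrakk> \<Longrightarrow> ract x q \<in> carrier M"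
    and lact_add_right: "\<lbrakk>p \<in> carrier P; x \<in> carrier M; y \<in> carrier M\<rbrakk>
          \<Longrightarrow> lact p (x \<oplus>\<^bsub>M\<^esub> y) = lact p x \<oplus>\<^bsub>M\<^esub> lact p y"
    and lact_add_left: "\<lbrakk>p \<in> carrier P; p' \<in> carrier P; x \<in> carrier M\<rbrakk>
          \<Longrightarrow> lact (p \<oplus>\<^bsub>P\<^esub> p') x = lact p x \<oplus>\<^bsub>M\<^esub> lact p' x"
    and ract_add_left: "\<lbrakk>x \<in> carrier M; y \<in> carrier M; q \<in> carrier Q\<rbrakk>
          \<Longrightarrow> ract (x \<oplus>\<^bsub>M\<^esub> y) q = ract x q \<oplus>\<^bsub>M\<^esub> ract y q"
    and ract_add_right: "\<lbrakk>x \<in> carrier M; q \<in> carrier Q; q' \<in> carrier Q\<rbrakk>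
          \<Longrightarrow> ract x (q \<oplus>\<^bsub>Q\<^esub> q') = ract x q \<oplus>\<^bsub>M\<^esub> ract x q'"
    and lact_mult: "\<lbrakk>p \<in> carrier P; p' \<in> carrier P; x \<in> carrier M\<rbrakk>
          \<Longrightarrow> lact (p \<otimes>\<^bsub>P\<^esub> p') x = lact p (lact p' x)"
    and ract_mult: "\<lbrakk>x \<in> carrier M; q \<in> carrier Q; q' \<in> carrier Q\<rbrakk>
          \<Longrightarrow> ract x (q \<otimes>\<^bsub>Q\<^esub> q') = ract (ract x q) q'"
    and lact_one: "x \<in> carrier M \<Longrightarrow> lact \<one>\<^bsub>P\<^esub> x = x"
    and ract_one: "x \<in> carrier M \<Longrightarrow> ract x \<one>\<^bsub>Q\<^esub> = x"
    and lact_ract: "\<lbrakk>p \<in> carrier P; x \<in> carrier M; q \<in> carrier Q\<rbrakk>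
          \<Longrightarrow> ract (lact p x) q = lact p (ract x q)"

text \<open>Generalized matrix data over the index set \<open>S\<close>: \<open>M i j\<close> is the \<open>(i, j)\<close> entry and
  \<open>\<mu> i j k\<close> is the product of \<open>M i j\<close> with \<open>M j k\<close>. For \<open>i \<noteq> j\<close> only the additive group of
  the record \<open>M i j\<close> is used. A bimodule morphism on the tensor product of \<open>M i j\<close> and \<open>M j k\<close> over
  \<open>M j j\<close> is given by the corresponding biadditive balanced map which commutes with the outer actions.\<close>

locale generalized_matrix_data =
  fixes S :: "'i set" and M :: "'i \<Rightarrow> 'i \<Rightarrow> ('a, 'm) ring_scheme"
    and \<mu> :: "'i \<Rightarrow> 'i \<Rightarrow> 'i \<Rightarrow> 'a \<Rightarrow> 'a \<Rightarrow> 'a"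
  assumes finite_index: "finite S"
    and ring_diag: "i \<in> S \<Longrightarrow> ring (M i i)"
    and \<mu>_diag: "\<lbrakk>i \<in> S; x \<in> carrier (M i i); y \<in> carrier (M i i)\<rbrakk>
          \<Longrightarrow> \<mu> i i i x y = x \<otimes>\<^bsub>M i i\<^esub> y"
    and bimodule_entry: "\<lbrakk>i \<in> S; j \<in> S\<rbrakk> \<Longrightarrow> bimodule (M i i) (M j j) (M i j) (\<mu> i i j) (\<mu> i j j)"
    and \<mu>_closed: "\<lbrakk>i \<in> S; j \<in> S; k \<in> S; x \<in> carrier (M i j); y \<in> carrier (M j k)\<rbrakk>
          \<Longrightarrow> \<mu> i j k x y \<in> carrier (M i k)"
    and \<mu>_add_left: "\<lbrakk>i \<in> S; j \<in> S; k \<in> S; x \<in> carrier (M i j); x' \<in> carrier (M i j);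
            y \<in> carrier (M j k)\<rbrakk>
          \<Longrightarrow> \<mu> i j k (x \<oplus>\<^bsub>M i j\<^esub> x') y = \<mu> i j k x y \<oplus>\<^bsub>M i k\<^esub> \<mu> i j k x' y"
    and \<mu>_add_right: "\<lbrakk>i \<in> S; j \<in> S; k \<in> S; x \<in> carrier (M i j); y \<in> carrier (M j k);
            y' \<in> carrier (M j k)\<rbrakk>
          \<Longrightarrow> \<mu> i j k x (y \<oplus>\<^bsub>M j k\<^esub> y') = \<mu> i j k x y \<oplus>\<^bsub>M i k\<^esub> \<mu> i j k x y'"
    and \<mu>_balanced: "\<lbrakk>i \<in> S; j \<in> S; k \<in> S; x \<in> carrier (M i j); b \<in> carrier (M j j);
            y \<in> carrier (M j k)\<rbrakk>
          \<Longrightarrow> \<mu> i j k (\<mu> i j j x b) y = \<mu> i j k x (\<mu> j j k b y)"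
    and \<mu>_lact: "\<lbrakk>i \<in> S; j \<in> S; k \<in> S; a \<in> carrier (M i i); x \<in> carrier (M i j);
            y \<in> carrier (M j k)\<rbrakk>
          \<Longrightarrow> \<mu> i j k (\<mu> i i j a x) y = \<mu> i i k a (\<mu> i j k x y)"
    and \<mu>_ract: "\<lbrakk>i \<in> S; j \<in> S; k \<in> S; x \<in> carrier (M i j); y \<in> carrier (M j k);
            c \<in> carrier (M k k)\<rbrakk>
          \<Longrightarrow> \<mu> i j k x (\<mu> j k k y c) = \<mu> i k k (\<mu> i j k x y) c"
    and \<mu>_assoc: "\<lbrakk>i \<in> S; j \<in> S; k \<in> S; l \<in> S; x \<in> carrier (M i j); y \<in> carrier (M j k);
            z \<in> carrier (M k l)\<rbrakk>
          \<Longrightarrow> \<mu> i k l (\<mu> i j k x y) z = \<mu> i j l x (\<mu> j k l y z)"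

definition generalized_matrix_ring ::
  "'i set \<Rightarrow> ('i \<Rightarrow> 'i \<Rightarrow> ('a, 'm) ring_scheme) \<Rightarrow> ('i \<Rightarrow> 'i \<Rightarrow> 'i \<Rightarrow> 'a \<Rightarrow> 'a \<Rightarrow> 'a)
    \<Rightarrow> ('i \<times> 'i \<Rightarrow> 'a) ring" where
  "generalized_matrix_ring S M \<mu> =
    \<lparr> carrier = (\<Pi>\<^sub>E (i, j)\<in>S \<times> S. carrier (M i j)),
      mult = (\<lambda>X Y. \<lambda>(i, k)\<in>S \<times> S. \<Oplus>\<^bsub>M i k\<^esub>j\<in>S. \<mu> i j k (X (i, j)) (Y (j, k))),
      one = (\<lambda>(i, j)\<in>S \<times> S. if i = j then \<one>\<^bsub>M i i\<^esub> else \<zero>\<^bsub>M i j\<^esub>),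
      zero = (\<lambda>(i, j)\<in>S \<times> S. \<zero>\<^bsub>M i j\<^esub>),
      add = (\<lambda>X Y. \<lambda>(i, j)\<in>S \<times> S. X (i, j) \<oplus>\<^bsub>M i j\<^esub> Y (i, j)) \<rparr>"


section \<open>The pair groupoid acting on a product of isomorphic rings\<close>

definition pair_groupoid :: "'i set \<Rightarrow> ('i \<times> 'i) groupoid_data" where
  "pair_groupoid S =
    \<lparr> arr = S \<times> S,
      src = (\<lambda>(i, j). (i, i)),
      tgt = (\<lambda>(i, j). (j, j)),
      cmp = (\<lambda>(j, k) (i, j'). (i, k)) \<rparr>"

definition product_ring :: "'i set \<Rightarrow> ('i \<Rightarrow> ('a, 'm) ring_scheme) \<Rightarrow> ('i \<Rightarrow> 'a) ring" where
  "product_ring S R =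
    \<lparr> carrier = (\<Pi>\<^sub>E i\<in>S. carrier (R i)),
      mult = (\<lambda>a b. \<lambda>i\<in>S. a i \<otimes>\<^bsub>R i\<^esub> b i),
      one = (\<lambda>i\<in>S. \<one>\<^bsub>R i\<^esub>),
      zero = (\<lambda>i\<in>S. \<zero>\<^bsub>R i\<^esub>),
      add = (\<lambda>a b. \<lambda>i\<in>S. a i \<oplus>\<^bsub>R i\<^esub> b i) \<rparr>"

text \<open>The embedding of \<open>R j\<close> as the \<open>j\<close>-th factor of the product; its image is the ideal of the
  product with which \<open>R j\<close> is identified.\<close>

definition factor_emb :: "'i set \<Rightarrow> ('i \<Rightarrow> ('a, 'm) ring_scheme) \<Rightarrow> 'i \<Rightarrow> 'a \<Rightarrow> 'i \<Rightarrow> 'a" where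
  "factor_emb S R j r = (\<lambda>k\<in>S. if k = j then r else \<zero>\<^bsub>R k\<^esub>)"

text \<open>In the following definitions \<open>\<theta> i\<close> is an isomorphism from \<open>R 1\<close> to \<open>R i\<close>, and
  \<open>transition R \<theta> i j\<close> is \<open>\<theta>\<^sub>i\<^sub>j = \<theta>\<^sub>j \<theta>\<^sub>i\<^sup>-\<^sup>1\<close> from \<open>R i\<close> to \<open>R j\<close>.\<close>

definition transition ::
  "(nat \<Rightarrow> ('a, 'm) ring_scheme) \<Rightarrow> (nat \<Rightarrow> 'a \<Rightarrow> 'a) \<Rightarrow> nat \<Rightarrow> nat \<Rightarrow> 'a \<Rightarrow> 'a" where
  "transition R \<theta> i j = \<theta> j \<circ> inv_into (carrier (R 1)) (\<theta> i)"

definition pair_ideal ::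
  "nat set \<Rightarrow> (nat \<Rightarrow> ('a, 'm) ring_scheme) \<Rightarrow> nat \<times> nat \<Rightarrow> (nat \<Rightarrow> 'a) set" where
  "pair_ideal S R = (\<lambda>(i, j). factor_emb S R j ` carrier (R j))"

definition pair_map ::
  "nat set \<Rightarrow> (nat \<Rightarrow> ('a, 'm) ring_scheme) \<Rightarrow> (nat \<Rightarrow> 'a \<Rightarrow> 'a)
    \<Rightarrow> nat \<times> nat \<Rightarrow> (nat \<Rightarrow> 'a) \<Rightarrow> nat \<Rightarrow> 'a" where
  "pair_map S R \<theta> = (\<lambda>(i, j) a. factor_emb S R j (transition R \<theta> i j (a i)))"

text \<open>The entry \<open>M i j = R\<^sub>i \<delta>\<^sub>(\<^sub>j\<^sub>,\<^sub>i\<^sub>)\<close> is a copy of \<open>R i\<close>. The symbol \<open>\<delta>\<^sub>(\<^sub>j\<^sub>,\<^sub>i\<^sub>)\<close> is determined by the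
  position \<open>(i, j)\<close> and is not stored, so the product of entries is
  \<open>(r \<delta>\<^sub>(\<^sub>j\<^sub>,\<^sub>i\<^sub>)) (s \<delta>\<^sub>(\<^sub>k\<^sub>,\<^sub>j\<^sub>)) = r \<theta>\<^sub>i\<^sub>j\<^sup>-\<^sup>1(s) \<delta>\<^sub>(\<^sub>k\<^sub>,\<^sub>i\<^sub>)\<close>.\<close>

definition matrix_entry :: "(nat \<Rightarrow> ('a, 'm) ring_scheme) \<Rightarrow> nat \<Rightarrow> nat \<Rightarrow> ('a, 'm) ring_scheme" where
  "matrix_entry R i j = R i"

definition matrix_product ::
  "(nat \<Rightarrow> ('a, 'm) ring_scheme) \<Rightarrow> (nat \<Rightarrow> 'a \<Rightarrow> 'a) \<Rightarrow> nat \<Rightarrow> nat \<Rightarrow> nat \<Rightarrow> 'a \<Rightarrow> 'a \<Rightarrow> 'a" where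
  "matrix_product R \<theta> i j k r s =
    r \<otimes>\<^bsub>R i\<^esub> inv_into (carrier (R i)) (transition R \<theta> i j) s"

end

theory Submission
  imports Defs
begin

text \<open>An arrow \<open>(k, i)\<close> of the pair groupoid factors as \<open>(j, i) (k, j)\<close>, in exactly one way for each
  object \<open>j\<close>. Hence the coefficient of \<open>\<delta>\<^sub>(\<^sub>k\<^sub>,\<^sub>i\<^sub>)\<close> in a product of the skew groupoid ring is
  \<open>\<Sum>\<^sub>j f(j, i) \<theta>\<^sub>j\<^sub>i(g(k, j))\<close>. Read at position \<open>(i, k)\<close>, this is the row-column rule with the entry
  product \<open>r \<theta>\<^sub>i\<^sub>j\<^sup>-\<^sup>1(s)\<close>, because \<open>\<theta>\<^sub>i\<^sub>j\<^sup>-\<^sup>1 = \<theta>\<^sub>j\<^sub>i\<close>. So transposing the positions turns matrices into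
  coefficient functions and respects products; the position has to be transposed because \<open>(j, i) (k, j)\<close>
  lists its indices in the order opposite to that of a path of matrix positions. The factor \<open>R\<^sub>i\<close>
  appears in the skew groupoid ring as an ideal of the product ring, so the map \<open>skew_of_matrix\<close> also
  applies the embedding of that factor; that it is multiplicative is \<open>skew_of_matrix_mult\<close>, with
  \<open>skew_product_nth\<close> supplying the coefficient formula.

  The ring axioms are checked only on the matrix side, for arbitrary generalized matrix data: the
  sums run over a fixed finite index set there, so associativity is a change of the order of
  summation. They pass to the skew groupoid ring along the bijection.

  The properties of the action and of the entry products all come from the cocycle rules
  \<open>\<theta>\<^sub>j\<^sub>k \<theta>\<^sub>i\<^sub>j = \<theta>\<^sub>i\<^sub>k\<close> and \<open>\<theta>\<^sub>i\<^sub>i = id\<close> for the transition isomorphisms.\<close>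

section \<open>Finite sums in abelian groups\<close>

lemma additive_zero:
  assumes "abelian_group X" "abelian_group Y"
    and closed: "\<And>x. x \<in> carrier X \<Longrightarrow> h x \<in> carrier Y"
    and add: "\<And>x y. \<lbrakk>x \<in> carrier X; y \<in> carrier X\<rbrakk> \<Longrightarrow> h (x \<oplus>\<^bsub>X\<^esub> y) = h x \<oplus>\<^bsub>Y\<^esub> h y"
  shows "h \<zero>\<^bsub>X\<^esub> = \<zero>\<^bsub>Y\<^esub>"
proof -
  interpret X: abelian_group X by fact
  interpret Y: abelian_group Y by fact
  have "h \<zero>\<^bsub>X\<^esub> \<oplus>\<^bsub>Y\<^esub> h \<zero>\<^bsub>X\<^esub> = h \<zero>\<^bsub>X\<^esub>"
    using add[of "\<zero>\<^bsub>X\<^esub>" "\<zero>\<^bsub>X\<^esub>"] by simp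
  with closed[of "\<zero>\<^bsub>X\<^esub>"] show ?thesis
    by (metis X.zero_closed Y.add.l_cancel_one)
qed

lemma additive_finsum:
  assumes "abelian_group X" "abelian_group Y"
    and closed: "\<And>x. x \<in> carrier X \<Longrightarrow> h x \<in> carrier Y"
    and add: "\<And>x y. \<lbrakk>x \<in> carrier X; y \<in> carrier X\<rbrakk> \<Longrightarrow> h (x \<oplus>\<^bsub>X\<^esub> y) = h x \<oplus>\<^bsub>Y\<^esub> h y"
    and "f \<in> B \<rightarrow> carrier X"
  shows "h (\<Oplus>\<^bsub>X\<^esub>b\<in>B. f b) = (\<Oplus>\<^bsub>Y\<^esub>b\<in>B. h (f b))"
proof -
  interpret X: abelian_group X by fact
  interpret Y: abelian_group Y by fact
  have zero: "h \<zero>\<^bsub>X\<^esub> = \<zero>\<^bsub>Y\<^esub>"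
    by (rule additive_zero) (fact assms)+
  show ?thesis
    using \<open>f \<in> B \<rightarrow> carrier X\<close>
  proof (induction B rule: infinite_finite_induct)
    case (insert b B)
    then have "f b \<in> carrier X" "f \<in> B \<rightarrow> carrier X"
      by auto
    moreover from this have "(\<lambda>b. h (f b)) \<in> B \<rightarrow> carrier Y"
      using closed by blast
    ultimately show ?case
      using insert by (simp add: add closed)
  qed (simp_all add: zero)
qed

lemma (in abelian_group) finsum_swap:
  assumes "finite B" "finite C"
    and f: "\<And>b c. \<lbrakk>b \<in> B; c \<in> C\<rbrakk> \<Longrightarrow> f b c \<in> carrier G"
  shows "(\<Oplus>b\<in>B. \<Oplus>c\<in>C. f b c) = (\<Oplus>c\<in>C. \<Oplus>b\<in>B. f b c)"
  using assms(1) f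
proof (induction B rule: finite_induct)
  case (insert b B)
  have b: "f b \<in> C \<rightarrow> carrier G"
    using insert by auto
  have B: "(\<lambda>b. \<Oplus>c\<in>C. f b c) \<in> B \<rightarrow> carrier G" "(\<lambda>c. \<Oplus>b\<in>B. f b c) \<in> C \<rightarrow> carrier G"
    using insert by (auto intro!: finsum_closed)
  have "(\<Oplus>b\<in>insert b B. \<Oplus>c\<in>C. f b c) = (\<Oplus>c\<in>C. f b c) \<oplus> (\<Oplus>b\<in>B. \<Oplus>c\<in>C. f b c)"
    using insert b B by (intro finsum_insert) auto
  also have "\<dots> = (\<Oplus>c\<in>C. f b c) \<oplus> (\<Oplus>c\<in>C. \<Oplus>b\<in>B. f b c)"
    using insert by simp
  also have "\<dots> = (\<Oplus>c\<in>C. f b c \<oplus> (\<Oplus>b\<in>B. f b c))"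
    using b B by simp
  also have "\<dots> = (\<Oplus>c\<in>C. \<Oplus>b\<in>insert b B. f b c)"
    using insert by (intro finsum_cong') (auto simp: Pi_iff intro!: finsum_insert[symmetric])
  finally show ?case .
qed simp

text \<open>Product rings and generalized matrix rings have different index sets and multiplications, but
  both add componentwise; this covers their additive groups together.\<close>

lemma pointwise_abelian_group:
  assumes "\<And>s. s \<in> S \<Longrightarrow> abelian_group (P s)"
    and "carrier Q = (\<Pi>\<^sub>E s\<in>S. carrier (P s))"
    and "zero Q = (\<lambda>s\<in>S. \<zero>\<^bsub>P s\<^esub>)"
    and "add Q = (\<lambda>f g. \<lambda>s\<in>S. f s \<oplus>\<^bsub>P s\<^esub> g s)"
  shows "abelian_group Q"
proof (rule abelian_groupI)
  fix f assume f: "f \<in> carrier Q"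
  show "\<exists>g\<in>carrier Q. g \<oplus>\<^bsub>Q\<^esub> f = \<zero>\<^bsub>Q\<^esub>"
  proof
    show "(\<lambda>s\<in>S. \<ominus>\<^bsub>P s\<^esub> f s) \<in> carrier Q"
      using f assms by (auto simp: PiE_iff abelian_group.a_inv_closed)
    show "(\<lambda>s\<in>S. \<ominus>\<^bsub>P s\<^esub> f s) \<oplus>\<^bsub>Q\<^esub> f = \<zero>\<^bsub>Q\<^esub>"
      using f assms by (auto simp: PiE_iff abelian_group.l_neg intro!: restrict_ext)
  qed
  show "\<zero>\<^bsub>Q\<^esub> \<oplus>\<^bsub>Q\<^esub> f = f"
    using f assms by (auto simp: PiE_iff abelian_groupE(2,5) extensional_def fun_eq_iff)
next
  fix f g h assume "f \<in> carrier Q" "g \<in> carrier Q" "h \<in> carrier Q"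
  then show "f \<oplus>\<^bsub>Q\<^esub> g \<oplus>\<^bsub>Q\<^esub> h = f \<oplus>\<^bsub>Q\<^esub> (g \<oplus>\<^bsub>Q\<^esub> h)"
    using assms by (auto simp: PiE_iff abelian_groupE(1,3) intro!: restrict_ext)
next
  fix f g assume "f \<in> carrier Q" "g \<in> carrier Q"
  then show "f \<oplus>\<^bsub>Q\<^esub> g \<in> carrier Q" "f \<oplus>\<^bsub>Q\<^esub> g = g \<oplus>\<^bsub>Q\<^esub> f"
    using assms by (auto simp: PiE_iff abelian_groupE intro!: restrict_ext)
qed (use assms in \<open>auto simp: abelian_groupE\<close>)


section \<open>Generalized matrix rings are rings\<close>

context generalized_matrix_data
begin

lemma entry_group: "\<lbrakk>i \<in> S; j \<in> S\<rbrakk> \<Longrightarrow> abelian_group (M i j)"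
  using bimodule_entry[of i j] by (simp add: bimodule_def)

lemma entry_one:
  assumes "i \<in> S" "j \<in> S" "x \<in> carrier (M i j)"
  shows "\<mu> i i j \<one>\<^bsub>M i i\<^esub> x = x" "\<mu> i j j x \<one>\<^bsub>M j j\<^esub> = x"
  using bimodule.lact_one[OF bimodule_entry] bimodule.ract_one[OF bimodule_entry] assms by auto

lemma entry_zero:
  assumes "i \<in> S" "j \<in> S" "k \<in> S"
  shows "y \<in> carrier (M j k) \<Longrightarrow> \<mu> i j k \<zero>\<^bsub>M i j\<^esub> y = \<zero>\<^bsub>M i k\<^esub>"
    and "x \<in> carrier (M i j) \<Longrightarrow> \<mu> i j k x \<zero>\<^bsub>M j k\<^esub> = \<zero>\<^bsub>M i k\<^esub>"
  by (rule additive_zero; simp add: assms entry_group \<mu>_closed \<mu>_add_left \<mu>_add_right)+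

lemma \<mu>_finsum_left:
  assumes "i \<in> S" "j \<in> S" "k \<in> S" "f \<in> B \<rightarrow> carrier (M i j)" "y \<in> carrier (M j k)"
  shows "\<mu> i j k (\<Oplus>\<^bsub>M i j\<^esub>b\<in>B. f b) y = (\<Oplus>\<^bsub>M i k\<^esub>b\<in>B. \<mu> i j k (f b) y)"
  using assms
  by (intro additive_finsum[where h = "\<lambda>x. \<mu> i j k x y", OF entry_group entry_group])
    (simp_all add: \<mu>_closed \<mu>_add_left)

lemma \<mu>_finsum_right:
  assumes "i \<in> S" "j \<in> S" "k \<in> S" "x \<in> carrier (M i j)" "f \<in> B \<rightarrow> carrier (M j k)"
  shows "\<mu> i j k x (\<Oplus>\<^bsub>M j k\<^esub>b\<in>B. f b) = (\<Oplus>\<^bsub>M i k\<^esub>b\<in>B. \<mu> i j k x (f b))"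
  using assms
  by (intro additive_finsum[where h = "\<mu> i j k x", OF entry_group entry_group])
    (simp_all add: \<mu>_closed \<mu>_add_right)

abbreviation matrices where "matrices \<equiv> generalized_matrix_ring S M \<mu>"

lemma matrices_carrier:
  "X \<in> carrier matrices \<longleftrightarrow>
    X \<in> extensional (S \<times> S) \<and> (\<forall>i\<in>S. \<forall>j\<in>S. X (i, j) \<in> carrier (M i j))"
  by (auto simp: generalized_matrix_ring_def PiE_iff)

lemma matrices_eqI:
  assumes "X \<in> carrier matrices" "Y \<in> carrier matrices"
    and "\<And>i j. \<lbrakk>i \<in> S; j \<in> S\<rbrakk> \<Longrightarrow> X (i, j) = Y (i, j)"
  shows "X = Y"
  using assms by (intro extensionalityI[of X "S \<times> S" Y]) (auto simp: matrices_carrier)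

lemma matrices_nth:
  assumes "i \<in> S" "j \<in> S"
  shows "(X \<otimes>\<^bsub>matrices\<^esub> Y) (i, j) = (\<Oplus>\<^bsub>M i j\<^esub>k\<in>S. \<mu> i k j (X (i, k)) (Y (k, j)))"
    and "(X \<oplus>\<^bsub>matrices\<^esub> Y) (i, j) = X (i, j) \<oplus>\<^bsub>M i j\<^esub> Y (i, j)"
    and "\<one>\<^bsub>matrices\<^esub> (i, j) = (if i = j then \<one>\<^bsub>M i i\<^esub> else \<zero>\<^bsub>M i j\<^esub>)"
    and "\<zero>\<^bsub>matrices\<^esub> (i, j) = \<zero>\<^bsub>M i j\<^esub>"
  using assms by (simp_all add: generalized_matrix_ring_def)

lemma matrices_entry: "\<lbrakk>X \<in> carrier matrices; i \<in> S; j \<in> S\<rbrakk> \<Longrightarrow> X (i, j) \<in> carrier (M i j)"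
  by (simp add: matrices_carrier)

lemma matrices_product_terms:
  assumes "X \<in> carrier matrices" "Y \<in> carrier matrices" "i \<in> S" "j \<in> S"
  shows "(\<lambda>k. \<mu> i k j (X (i, k)) (Y (k, j))) \<in> S \<rightarrow> carrier (M i j)"
  using assms by (auto simp: matrices_entry \<mu>_closed)

lemma matrices_mult_closed:
  assumes "X \<in> carrier matrices" "Y \<in> carrier matrices"
  shows "X \<otimes>\<^bsub>matrices\<^esub> Y \<in> carrier matrices"
  unfolding matrices_carrier
  using abelian_monoid.finsum_closed[OF abelian_group.axioms(1)[OF entry_group] matrices_product_terms[OF assms]]
  by (auto simp: matrices_nth) (auto simp: generalized_matrix_ring_def)

lemma matrices_group: "abelian_group matrices"
  by (rule pointwise_abelian_group[where S = "S \<times> S" and P = "\<lambda>(i, j). M i j"])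
    (auto simp: generalized_matrix_ring_def entry_group fun_eq_iff
      intro!: PiE_cong)

lemma matrices_one_closed: "\<one>\<^bsub>matrices\<^esub> \<in> carrier matrices"
proof -
  have "\<one>\<^bsub>matrices\<^esub> (i, j) \<in> carrier (M i j)" if "i \<in> S" "j \<in> S" for i j
    using that by (simp add: matrices_nth abelian_groupE(2) entry_group monoid.one_closed ringE(2) ring_diag)
  then show ?thesis
    by (auto simp: matrices_carrier) (simp add: generalized_matrix_ring_def)
qed

text \<open>Both sides are the sum of \<open>x\<^sub>i\<^sub>j (y\<^sub>j\<^sub>k z\<^sub>k\<^sub>l)\<close> over all \<open>j\<close> and \<open>k\<close>, in the two orders of summation.\<close>

lemma matrices_assoc:
  assumes X: "X \<in> carrier matrices" and Y: "Y \<in> carrier matrices" and Z: "Z \<in> carrier matrices"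
  shows "X \<otimes>\<^bsub>matrices\<^esub> Y \<otimes>\<^bsub>matrices\<^esub> Z = X \<otimes>\<^bsub>matrices\<^esub> (Y \<otimes>\<^bsub>matrices\<^esub> Z)"
proof (rule matrices_eqI)
  fix i l assume il: "i \<in> S" "l \<in> S"
  interpret il: abelian_group "M i l" using il by (rule entry_group)
  let ?t = "\<lambda>j k. \<mu> i j l (X (i, j)) (\<mu> j k l (Y (j, k)) (Z (k, l)))"
  have t: "?t j k \<in> carrier (M i l)" if "j \<in> S" "k \<in> S" for j k
    using that il X Y Z by (simp add: matrices_entry \<mu>_closed)
  have "(X \<otimes>\<^bsub>matrices\<^esub> Y \<otimes>\<^bsub>matrices\<^esub> Z) (i, l) =
      (\<Oplus>\<^bsub>M i l\<^esub>k\<in>S. \<mu> i k l (\<Oplus>\<^bsub>M i k\<^esub>j\<in>S. \<mu> i j k (X (i, j)) (Y (j, k))) (Z (k, l)))"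
    using il X Y Z matrices_product_terms[OF matrices_mult_closed[OF X Y] Z il]
    by (simp add: matrices_nth cong: il.finsum_cong)
  also have "\<dots> = (\<Oplus>\<^bsub>M i l\<^esub>k\<in>S. \<Oplus>\<^bsub>M i l\<^esub>j\<in>S. ?t j k)"
  proof (rule il.finsum_cong')
    fix k assume k: "k \<in> S"
    have "\<mu> i k l (\<Oplus>\<^bsub>M i k\<^esub>j\<in>S. \<mu> i j k (X (i, j)) (Y (j, k))) (Z (k, l)) =
        (\<Oplus>\<^bsub>M i l\<^esub>j\<in>S. \<mu> i k l (\<mu> i j k (X (i, j)) (Y (j, k))) (Z (k, l)))"
      using k il Z matrices_product_terms[OF X Y] by (intro \<mu>_finsum_left) (auto simp: matrices_entry)
    also have "\<dots> = (\<Oplus>\<^bsub>M i l\<^esub>j\<in>S. ?t j k)"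
      using k il X Y Z t by (intro il.finsum_cong') (auto simp: \<mu>_assoc matrices_entry)
    finally show "\<mu> i k l (\<Oplus>\<^bsub>M i k\<^esub>j\<in>S. \<mu> i j k (X (i, j)) (Y (j, k))) (Z (k, l)) =
        (\<Oplus>\<^bsub>M i l\<^esub>j\<in>S. ?t j k)" .
  qed (use t in \<open>auto intro!: il.finsum_closed\<close>)
  also have "\<dots> = (\<Oplus>\<^bsub>M i l\<^esub>j\<in>S. \<Oplus>\<^bsub>M i l\<^esub>k\<in>S. ?t j k)"
    using t by (intro il.finsum_swap finite_index)
  also have "\<dots> = (\<Oplus>\<^bsub>M i l\<^esub>j\<in>S. \<mu> i j l (X (i, j)) (\<Oplus>\<^bsub>M j l\<^esub>k\<in>S. \<mu> j k l (Y (j, k)) (Z (k, l))))"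
  proof (rule il.finsum_cong')
    have sum: "(\<Oplus>\<^bsub>M j l\<^esub>k\<in>S. \<mu> j k l (Y (j, k)) (Z (k, l))) \<in> carrier (M j l)" if "j \<in> S" for j
      using matrices_entry[OF matrices_mult_closed[OF Y Z] that il(2)] that il by (simp add: matrices_nth)
    show "(\<lambda>j. \<mu> i j l (X (i, j)) (\<Oplus>\<^bsub>M j l\<^esub>k\<in>S. \<mu> j k l (Y (j, k)) (Z (k, l)))) \<in> S \<rightarrow> carrier (M i l)"
      using sum il X by (auto intro!: \<mu>_closed simp: matrices_entry)
    fix j assume j: "j \<in> S"
    show "(\<Oplus>\<^bsub>M i l\<^esub>k\<in>S. ?t j k) =
        \<mu> i j l (X (i, j)) (\<Oplus>\<^bsub>M j l\<^esub>k\<in>S. \<mu> j k l (Y (j, k)) (Z (k, l)))"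
      using j il X matrices_product_terms[OF Y Z]
      by (intro \<mu>_finsum_right[symmetric]) (auto simp: matrices_entry)
  qed simp
  also have "\<dots> = (X \<otimes>\<^bsub>matrices\<^esub> (Y \<otimes>\<^bsub>matrices\<^esub> Z)) (i, l)"
    using il X Y Z matrices_product_terms[OF X matrices_mult_closed[OF Y Z] il]
    by (simp add: matrices_nth cong: il.finsum_cong)
  finally show "(X \<otimes>\<^bsub>matrices\<^esub> Y \<otimes>\<^bsub>matrices\<^esub> Z) (i, l) =
      (X \<otimes>\<^bsub>matrices\<^esub> (Y \<otimes>\<^bsub>matrices\<^esub> Z)) (i, l)" .
qed (intro matrices_mult_closed X Y Z)+

lemma matrices_one:
  assumes X: "X \<in> carrier matrices"
  shows "\<one>\<^bsub>matrices\<^esub> \<otimes>\<^bsub>matrices\<^esub> X = X" "X \<otimes>\<^bsub>matrices\<^esub> \<one>\<^bsub>matrices\<^esub> = X"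
proof -
  show "\<one>\<^bsub>matrices\<^esub> \<otimes>\<^bsub>matrices\<^esub> X = X"
  proof (rule matrices_eqI)
    fix i j assume ij: "i \<in> S" "j \<in> S"
    interpret ij: abelian_group "M i j" using ij by (rule entry_group)
    \<comment> \<open>The surviving entry is written \<open>X (i, j)\<close> and not \<open>X (k, j)\<close>: the latter lies in \<open>M k j\<close>, so
      it would not be a family of elements of the group \<open>M i j\<close> in which the sum is taken.\<close>
    have "(\<one>\<^bsub>matrices\<^esub> \<otimes>\<^bsub>matrices\<^esub> X) (i, j) = (\<Oplus>\<^bsub>M i j\<^esub>k\<in>S. if i = k then X (i, j) else \<zero>\<^bsub>M i j\<^esub>)"
      unfolding matrices_nth(1)[OF ij] using ij X
      by (intro ij.finsum_cong') (auto simp: matrices_nth matrices_entry entry_one entry_zero)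
    also have "\<dots> = X (i, j)"
      using ij X finite_index
      by (intro ij.finsum_singleton[where f = "\<lambda>_. X (i, j)"]) (auto simp: matrices_entry)
    finally show "(\<one>\<^bsub>matrices\<^esub> \<otimes>\<^bsub>matrices\<^esub> X) (i, j) = X (i, j)" .
  qed (intro matrices_mult_closed matrices_one_closed X)+
  show "X \<otimes>\<^bsub>matrices\<^esub> \<one>\<^bsub>matrices\<^esub> = X"
  proof (rule matrices_eqI)
    fix i j assume ij: "i \<in> S" "j \<in> S"
    interpret ij: abelian_group "M i j" using ij by (rule entry_group)
    have "(X \<otimes>\<^bsub>matrices\<^esub> \<one>\<^bsub>matrices\<^esub>) (i, j) = (\<Oplus>\<^bsub>M i j\<^esub>k\<in>S. if j = k then X (i, j) else \<zero>\<^bsub>M i j\<^esub>)"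
      unfolding matrices_nth(1)[OF ij] using ij X
      by (intro ij.finsum_cong') (auto simp: matrices_nth matrices_entry entry_one entry_zero)
    also have "\<dots> = X (i, j)"
      using ij X finite_index
      by (intro ij.finsum_singleton[where f = "\<lambda>_. X (i, j)"]) (auto simp: matrices_entry)
    finally show "(X \<otimes>\<^bsub>matrices\<^esub> \<one>\<^bsub>matrices\<^esub>) (i, j) = X (i, j)" .
  qed (intro matrices_mult_closed matrices_one_closed X)+
qed

theorem matrices_ring: "ring matrices"
proof (rule ringI)
  show "abelian_group matrices" by (rule matrices_group)
  show "monoid matrices"
    by (rule monoidI) (simp_all add: matrices_mult_closed matrices_one_closed matrices_assoc matrices_one)
next
  fix X Y Z assume XYZ: "X \<in> carrier matrices" "Y \<in> carrier matrices" "Z \<in> carrier matrices"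
  interpret abelian_group matrices by (rule matrices_group)
  show "(X \<oplus>\<^bsub>matrices\<^esub> Y) \<otimes>\<^bsub>matrices\<^esub> Z = X \<otimes>\<^bsub>matrices\<^esub> Z \<oplus>\<^bsub>matrices\<^esub> Y \<otimes>\<^bsub>matrices\<^esub> Z"
  proof (rule matrices_eqI)
    fix i j assume ij: "i \<in> S" "j \<in> S"
    interpret ij: abelian_group "M i j" using ij by (rule entry_group)
    show "((X \<oplus>\<^bsub>matrices\<^esub> Y) \<otimes>\<^bsub>matrices\<^esub> Z) (i, j) = (X \<otimes>\<^bsub>matrices\<^esub> Z \<oplus>\<^bsub>matrices\<^esub> Y \<otimes>\<^bsub>matrices\<^esub> Z) (i, j)"
      unfolding matrices_nth(1,2)[OF ij] using ij XYZ
      by (intro trans[OF ij.finsum_cong' ij.finsum_addf] matrices_product_terms)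
        (auto simp: matrices_nth(2) matrices_entry \<mu>_add_left \<mu>_closed)
  qed (simp_all add: matrices_mult_closed XYZ)
  show "Z \<otimes>\<^bsub>matrices\<^esub> (X \<oplus>\<^bsub>matrices\<^esub> Y) = Z \<otimes>\<^bsub>matrices\<^esub> X \<oplus>\<^bsub>matrices\<^esub> Z \<otimes>\<^bsub>matrices\<^esub> Y"
  proof (rule matrices_eqI)
    fix i j assume ij: "i \<in> S" "j \<in> S"
    interpret ij: abelian_group "M i j" using ij by (rule entry_group)
    show "(Z \<otimes>\<^bsub>matrices\<^esub> (X \<oplus>\<^bsub>matrices\<^esub> Y)) (i, j) = (Z \<otimes>\<^bsub>matrices\<^esub> X \<oplus>\<^bsub>matrices\<^esub> Z \<otimes>\<^bsub>matrices\<^esub> Y) (i, j)"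
      unfolding matrices_nth(1,2)[OF ij] using ij XYZ
      by (intro trans[OF ij.finsum_cong' ij.finsum_addf] matrices_product_terms)
        (auto simp: matrices_nth(2) matrices_entry \<mu>_add_right \<mu>_closed)
  qed (simp_all add: matrices_mult_closed XYZ)
qed

end


section \<open>Products of rings and their factors\<close>

lemma product_ring_ring:
  assumes "\<And>i. i \<in> S \<Longrightarrow> ring (R i)"
  shows "ring (product_ring S R)"
proof (rule ringI)
  show "abelian_group (product_ring S R)"
    by (rule pointwise_abelian_group[where S = S and P = R])
      (simp_all add: product_ring_def ringE(1) assms)
  show "monoid (product_ring S R)"
    using assms[THEN ringE(2)]
    by (intro monoidI)
      (auto simp: product_ring_def PiE_iff monoid.m_closed monoid.one_closed monoid.m_assoc
        monoid.l_one monoid.r_one extensional_def fun_eq_iff)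
qed (use assms[THEN ringE(3)] assms[THEN ringE(4)] in
    \<open>auto simp: product_ring_def PiE_iff intro!: restrict_ext\<close>)

locale ring_family =
  fixes S :: "'i set" and R :: "'i \<Rightarrow> ('a, 'm) ring_scheme"
  assumes factor_ring: "i \<in> S \<Longrightarrow> ring (R i)"
begin

abbreviation A where "A \<equiv> product_ring S R"
abbreviation emb where "emb \<equiv> factor_emb S R"

lemma A_ring: "ring A"
  by (rule product_ring_ring) (rule factor_ring)

lemma factor_ops:
  assumes "i \<in> S"
  shows "\<zero>\<^bsub>R i\<^esub> \<in> carrier (R i)" "\<one>\<^bsub>R i\<^esub> \<in> carrier (R i)"
    and "\<And>x y. \<lbrakk>x \<in> carrier (R i); y \<in> carrier (R i)\<rbrakk> \<Longrightarrow> x \<otimes>\<^bsub>R i\<^esub> y \<in> carrier (R i)"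
    and "\<And>x y. \<lbrakk>x \<in> carrier (R i); y \<in> carrier (R i)\<rbrakk> \<Longrightarrow> x \<oplus>\<^bsub>R i\<^esub> y \<in> carrier (R i)"
    and "\<And>x. x \<in> carrier (R i) \<Longrightarrow> \<one>\<^bsub>R i\<^esub> \<otimes>\<^bsub>R i\<^esub> x = x"
    and "\<And>x. x \<in> carrier (R i) \<Longrightarrow> x \<otimes>\<^bsub>R i\<^esub> \<one>\<^bsub>R i\<^esub> = x"
    and "\<And>x. x \<in> carrier (R i) \<Longrightarrow> \<zero>\<^bsub>R i\<^esub> \<otimes>\<^bsub>R i\<^esub> x = \<zero>\<^bsub>R i\<^esub>"
    and "\<And>x. x \<in> carrier (R i) \<Longrightarrow> x \<otimes>\<^bsub>R i\<^esub> \<zero>\<^bsub>R i\<^esub> = \<zero>\<^bsub>R i\<^esub>"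
    and "\<And>x. x \<in> carrier (R i) \<Longrightarrow> \<zero>\<^bsub>R i\<^esub> \<oplus>\<^bsub>R i\<^esub> x = x"
    and "\<And>x. x \<in> carrier (R i) \<Longrightarrow> x \<oplus>\<^bsub>R i\<^esub> \<zero>\<^bsub>R i\<^esub> = x"
proof -
  interpret ring "R i" using assms by (rule factor_ring)
  show "\<zero>\<^bsub>R i\<^esub> \<in> carrier (R i)" "\<one>\<^bsub>R i\<^esub> \<in> carrier (R i)"
    "\<And>x y. \<lbrakk>x \<in> carrier (R i); y \<in> carrier (R i)\<rbrakk> \<Longrightarrow> x \<otimes>\<^bsub>R i\<^esub> y \<in> carrier (R i)"
    "\<And>x y. \<lbrakk>x \<in> carrier (R i); y \<in> carrier (R i)\<rbrakk> \<Longrightarrow> x \<oplus>\<^bsub>R i\<^esub> y \<in> carrier (R i)"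
    "\<And>x. x \<in> carrier (R i) \<Longrightarrow> \<one>\<^bsub>R i\<^esub> \<otimes>\<^bsub>R i\<^esub> x = x"
    "\<And>x. x \<in> carrier (R i) \<Longrightarrow> x \<otimes>\<^bsub>R i\<^esub> \<one>\<^bsub>R i\<^esub> = x"
    "\<And>x. x \<in> carrier (R i) \<Longrightarrow> \<zero>\<^bsub>R i\<^esub> \<otimes>\<^bsub>R i\<^esub> x = \<zero>\<^bsub>R i\<^esub>"
    "\<And>x. x \<in> carrier (R i) \<Longrightarrow> x \<otimes>\<^bsub>R i\<^esub> \<zero>\<^bsub>R i\<^esub> = \<zero>\<^bsub>R i\<^esub>"
    "\<And>x. x \<in> carrier (R i) \<Longrightarrow> \<zero>\<^bsub>R i\<^esub> \<oplus>\<^bsub>R i\<^esub> x = x"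
    "\<And>x. x \<in> carrier (R i) \<Longrightarrow> x \<oplus>\<^bsub>R i\<^esub> \<zero>\<^bsub>R i\<^esub> = x"
    by simp_all
qed

lemma emb_closed: "\<lbrakk>i \<in> S; r \<in> carrier (R i)\<rbrakk> \<Longrightarrow> emb i r \<in> carrier A"
  by (auto simp: factor_emb_def product_ring_def factor_ops(1))

lemma emb_nth: "i \<in> S \<Longrightarrow> emb i r i = r"
  by (simp add: factor_emb_def)

lemma emb_eq_iff: "i \<in> S \<Longrightarrow> emb i r = emb i s \<longleftrightarrow> r = s"
  by (metis emb_nth)

text \<open>Together with \<open>emb_add\<close> and \<open>emb_mult\<close> this identifies \<open>R i\<close> with an ideal of the product. The
  embedding does not preserve units: the unit of that ideal is found in \<open>factor_unit\<close>.\<close>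

lemma emb_zero: "emb i \<zero>\<^bsub>R i\<^esub> = \<zero>\<^bsub>A\<^esub>"
  by (auto simp: factor_emb_def product_ring_def)

lemma emb_add:
  "\<lbrakk>i \<in> S; r \<in> carrier (R i); s \<in> carrier (R i)\<rbrakk> \<Longrightarrow> emb i (r \<oplus>\<^bsub>R i\<^esub> s) = emb i r \<oplus>\<^bsub>A\<^esub> emb i s"
  by (auto simp: factor_emb_def product_ring_def PiE_iff factor_ops intro!: restrict_ext)

lemma emb_mult_left:
  "\<lbrakk>i \<in> S; r \<in> carrier (R i); a \<in> carrier A\<rbrakk> \<Longrightarrow> emb i r \<otimes>\<^bsub>A\<^esub> a = emb i (r \<otimes>\<^bsub>R i\<^esub> a i)"
  by (auto simp: factor_emb_def product_ring_def PiE_iff factor_ops intro!: restrict_ext)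

lemma emb_mult_right:
  "\<lbrakk>i \<in> S; r \<in> carrier (R i); a \<in> carrier A\<rbrakk> \<Longrightarrow> a \<otimes>\<^bsub>A\<^esub> emb i r = emb i (a i \<otimes>\<^bsub>R i\<^esub> r)"
  by (auto simp: factor_emb_def product_ring_def PiE_iff factor_ops intro!: restrict_ext)

lemma emb_mult:
  "\<lbrakk>i \<in> S; r \<in> carrier (R i); s \<in> carrier (R i)\<rbrakk> \<Longrightarrow> emb i r \<otimes>\<^bsub>A\<^esub> emb i s = emb i (r \<otimes>\<^bsub>R i\<^esub> s)"
  by (simp add: emb_mult_left emb_closed emb_nth)

text \<open>By \<open>emb_mult_left\<close> and \<open>emb_mult_right\<close>, multiplying by an element of the product changes only
  the \<open>i\<close>-th component, by a multiplication inside \<open>R i\<close>.\<close>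

lemma factor_ideal:
  assumes i: "i \<in> S"
  shows "ideal (emb i ` carrier (R i)) A"
proof (rule idealI)
  interpret A: ring A by (rule A_ring)
  interpret Ri: ring "R i" using i by (rule factor_ring)
  show "subgroup (emb i ` carrier (R i)) (add_monoid A)"
  proof (rule group.subgroupI[OF A.a_group])
    fix a assume "a \<in> emb i ` carrier (R i)"
    then obtain r where r: "r \<in> carrier (R i)" "a = emb i r" by auto
    have "emb i (\<ominus>\<^bsub>R i\<^esub> r) \<oplus>\<^bsub>A\<^esub> emb i r = \<zero>\<^bsub>A\<^esub>"
      using i r by (simp add: emb_add[symmetric] Ri.l_neg emb_zero)
    then have "\<ominus>\<^bsub>A\<^esub> a = emb i (\<ominus>\<^bsub>R i\<^esub> r)"
      using i r by (simp add: A.minus_equality emb_closed)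
    then show "inv\<^bsub>add_monoid A\<^esub> a \<in> emb i ` carrier (R i)"
      using r Ri.a_inv_closed[of r] by (simp only: a_inv_def image_eqI)
  qed (use i in \<open>auto simp: emb_closed emb_add[symmetric]\<close>)
next
  fix a x assume "a \<in> emb i ` carrier (R i)" "x \<in> carrier A"
  moreover from this have "x i \<in> carrier (R i)" using i by (auto simp: product_ring_def)
  ultimately show "x \<otimes>\<^bsub>A\<^esub> a \<in> emb i ` carrier (R i)" "a \<otimes>\<^bsub>A\<^esub> x \<in> emb i ` carrier (R i)"
    using i by (auto simp: emb_mult_left emb_mult_right factor_ops)
qed (rule A_ring)

lemma factor_unit:
  assumes i: "i \<in> S"
  shows "ideal_unit A (emb i ` carrier (R i)) = emb i \<one>\<^bsub>R i\<^esub>"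
  unfolding ideal_unit_def
proof (rule the_equality)
  show "emb i \<one>\<^bsub>R i\<^esub> \<in> emb i ` carrier (R i) \<and>
    (\<forall>a\<in>emb i ` carrier (R i). emb i \<one>\<^bsub>R i\<^esub> \<otimes>\<^bsub>A\<^esub> a = a \<and> a \<otimes>\<^bsub>A\<^esub> emb i \<one>\<^bsub>R i\<^esub> = a)"
    using i by (auto simp: emb_mult factor_ops)
next
  fix e assume e: "e \<in> emb i ` carrier (R i) \<and>
    (\<forall>a\<in>emb i ` carrier (R i). e \<otimes>\<^bsub>A\<^esub> a = a \<and> a \<otimes>\<^bsub>A\<^esub> e = a)"
  then obtain r where "r \<in> carrier (R i)" "e = emb i r" by auto
  moreover have "e \<otimes>\<^bsub>A\<^esub> emb i \<one>\<^bsub>R i\<^esub> = emb i \<one>\<^bsub>R i\<^esub>"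
    using e i by (simp add: factor_ops)
  ultimately show "e = emb i \<one>\<^bsub>R i\<^esub>"
    using i by (simp add: emb_mult factor_ops)
qed

lemma emb_finsum:
  assumes "i \<in> S" "f \<in> B \<rightarrow> carrier (R i)"
  shows "emb i (\<Oplus>\<^bsub>R i\<^esub>b\<in>B. f b) = (\<Oplus>\<^bsub>A\<^esub>b\<in>B. emb i (f b))"
  using assms by (intro additive_finsum ringE(1) factor_ring A_ring emb_closed emb_add)

end


section \<open>The pair groupoid\<close>

lemma pair_groupoid_simps [simp]:
  "arr (pair_groupoid S) = S \<times> S"
  "src (pair_groupoid S) (i, j) = (i, i)"
  "tgt (pair_groupoid S) (i, j) = (j, j)"
  "cmp (pair_groupoid S) (j, k) (i, j') = (i, k)"
  by (simp_all add: pair_groupoid_def)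

lemma objects_pair_groupoid: "objects (pair_groupoid S) = (\<lambda>i. (i, i)) ` S"
  by (force simp: objects_def)

lemma pair_groupoid_groupoid: "groupoid (pair_groupoid S)"
  by (unfold_locales) (force simp: objects_pair_groupoid)+


section \<open>The transition isomorphisms\<close>

text \<open>The ring \<open>R 1\<close> is the base point: every transition isomorphism passes through it, so its index
  must belong to \<open>S\<close>.\<close>

locale isomorphic_rings = ring_family S R
  for S :: "nat set" and R :: "nat \<Rightarrow> ('a, 'm) ring_scheme" +
  fixes \<theta> :: "nat \<Rightarrow> 'a \<Rightarrow> 'a"
  assumes finite_S: "finite S"
    and base_in_S: "1 \<in> S"
    and \<theta>_iso: "i \<in> S \<Longrightarrow> \<theta> i \<in> ring_iso (R 1) (R i)"
begin

abbreviation T where "T \<equiv> transition R \<theta>"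

lemma \<theta>_bij: "i \<in> S \<Longrightarrow> bij_betw (\<theta> i) (carrier (R 1)) (carrier (R i))"
  using \<theta>_iso ring_iso_memE(5) by blast

lemma transition_iso:
  assumes "i \<in> S" "j \<in> S"
  shows "T i j \<in> ring_iso (R i) (R j)"
  unfolding transition_def
  by (rule ring_iso_set_trans[OF ring_iso_set_sym[OF factor_ring \<theta>_iso] \<theta>_iso])
    (fact base_in_S assms)+

lemmas transition_closed = transition_iso[THEN ring_iso_memE(1)]
  and transition_mult = transition_iso[THEN ring_iso_memE(2)]
  and transition_add = transition_iso[THEN ring_iso_memE(3)]
  and transition_one = transition_iso[THEN ring_iso_memE(4)]
  and transition_bij = transition_iso[THEN ring_iso_memE(5)]

lemma transition_zero: "\<lbrakk>i \<in> S; j \<in> S\<rbrakk> \<Longrightarrow> T i j \<zero>\<^bsub>R i\<^esub> = \<zero>\<^bsub>R j\<^esub>"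
  by (rule additive_zero) (simp_all add: ringE(1) factor_ring transition_closed transition_add)

lemma transition_refl: "\<lbrakk>i \<in> S; x \<in> carrier (R i)\<rbrakk> \<Longrightarrow> T i i x = x"
  using \<theta>_bij[of i] by (simp add: transition_def bij_betw_inv_into_right)

lemma transition_trans:
  assumes "i \<in> S" "j \<in> S" "k \<in> S" "x \<in> carrier (R i)"
  shows "T j k (T i j x) = T i k x"
proof -
  have "inv_into (carrier (R 1)) (\<theta> i) x \<in> carrier (R 1)"
    using assms \<theta>_bij[of i] bij_betw_imp_surj_on inv_into_into by metis
  then show ?thesis
    using assms \<theta>_bij[of j] by (simp add: transition_def bij_betw_inv_into_left)
qed

text \<open>This replaces the inverse in the entry product by a transition isomorphism, so that the cocycle
  rule \<open>transition_trans\<close> applies to it.\<close>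

lemma transition_inv:
  assumes "i \<in> S" "j \<in> S" "y \<in> carrier (R j)"
  shows "inv_into (carrier (R i)) (T i j) y = T j i y"
proof -
  have "inv_into (carrier (R i)) (T i j) (T i j (T j i y)) = T j i y"
    using assms transition_bij[of i j] by (simp add: bij_betw_inv_into_left transition_closed)
  then show ?thesis
    using assms by (simp add: transition_trans transition_refl)
qed

section \<open>The action and the matrix data\<close>

abbreviation G where "G \<equiv> pair_groupoid S"
abbreviation I where "I \<equiv> pair_ideal S R"
abbreviation \<phi> where "\<phi> \<equiv> pair_map S R \<theta>"
abbreviation M where "M \<equiv> matrix_entry R"
abbreviation \<mu> where "\<mu> \<equiv> matrix_product R \<theta>"

lemma pair_ideal_eq: "I (i, j) = emb j ` carrier (R j)"
  by (simp add: pair_ideal_def)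

lemma pair_map_emb: "i \<in> S \<Longrightarrow> \<phi> (i, j) (emb i r) = emb j (T i j r)"
  by (simp add: pair_map_def emb_nth)

text \<open>On an embedded element, \<open>\<phi> (i, j)\<close> is \<open>T i j\<close> by \<open>pair_map_emb\<close>, so the axioms for \<open>\<phi>\<close> become those
  properties of \<open>T\<close> that say it is a functor from the pair groupoid to rings.\<close>

lemma pair_action: "groupoid_action G A I \<phi>"
proof -
  have "groupoid_action_axioms G A I \<phi>"
  proof (rule groupoid_action_axioms.intro)
    fix u assume "u \<in> arr G"
    then obtain i j where ij: "u = (i, j)" "i \<in> S" "j \<in> S" by auto
    show "ideal (I u) A"
      using ij by (simp add: pair_ideal_eq factor_ideal)
    show "I u = I (tgt G u)"
      using ij by (simp add: pair_ideal_eq)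
    show "bij_betw (\<phi> u) (I (src G u)) (I u)"
    proof -
      have "inj_on (\<phi> u) (I (src G u))"
        using ij transition_bij[of i j]
        by (auto intro!: inj_onI simp: pair_ideal_eq pair_map_emb emb_eq_iff bij_betw_def inj_on_eq_iff)
      moreover have "\<phi> u ` I (src G u) = emb j ` T i j ` carrier (R i)"
        using ij by (auto simp: pair_ideal_eq pair_map_emb image_image)
      ultimately show ?thesis
        using ij transition_bij[of i j] by (simp add: bij_betw_def pair_ideal_eq)
    qed
    fix a b assume "a \<in> I (src G u)" "b \<in> I (src G u)"
    with ij show "\<phi> u (a \<oplus>\<^bsub>A\<^esub> b) = \<phi> u a \<oplus>\<^bsub>A\<^esub> \<phi> u b" "\<phi> u (a \<otimes>\<^bsub>A\<^esub> b) = \<phi> u a \<otimes>\<^bsub>A\<^esub> \<phi> u b"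
      by (auto simp: pair_ideal_eq pair_map_emb emb_add[symmetric] emb_mult transition_closed
          transition_add transition_mult)
  next
    fix e a assume "e \<in> objects G" "a \<in> I e"
    then show "\<phi> e a = a"
      by (auto simp: objects_pair_groupoid pair_ideal_eq pair_map_emb transition_refl)
  next
    fix u v a assume "u \<in> arr G" "v \<in> arr G" "src G u = tgt G v" "a \<in> I (src G v)"
    then show "\<phi> u (\<phi> v a) = \<phi> (cmp G u v) a"
      by (auto simp: pair_ideal_eq pair_map_emb transition_trans)
  qed
  then show ?thesis
    by (intro groupoid_action.intro pair_groupoid_groupoid A_ring)
qed

lemma matrix_product_eq:
  "\<lbrakk>i \<in> S; j \<in> S; s \<in> carrier (R j)\<rbrakk> \<Longrightarrow> \<mu> i j k r s = r \<otimes>\<^bsub>R i\<^esub> T j i s"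
  by (simp add: matrix_product_def transition_inv)

lemma matrix_product_closed:
  "\<lbrakk>i \<in> S; j \<in> S; r \<in> carrier (R i); s \<in> carrier (R j)\<rbrakk> \<Longrightarrow> \<mu> i j k r s \<in> carrier (R i)"
  by (simp add: matrix_product_eq factor_ops transition_closed)

lemma matrix_product_add:
  assumes "i \<in> S" "j \<in> S" "r \<in> carrier (R i)" "s \<in> carrier (R j)"
  shows "r' \<in> carrier (R i) \<Longrightarrow> \<mu> i j k (r \<oplus>\<^bsub>R i\<^esub> r') s = \<mu> i j k r s \<oplus>\<^bsub>R i\<^esub> \<mu> i j k r' s"
    and "s' \<in> carrier (R j) \<Longrightarrow> \<mu> i j k r (s \<oplus>\<^bsub>R j\<^esub> s') = \<mu> i j k r s \<oplus>\<^bsub>R i\<^esub> \<mu> i j k r s'"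
  using assms factor_ring[of i]
  by (simp_all add: matrix_product_eq factor_ops transition_add transition_closed ringE(3,4))

text \<open>Both sides equal \<open>x \<cdot> T j i y \<cdot> T k i z\<close>: the isomorphism \<open>T j i\<close> is multiplicative, and it takes
  \<open>T k j z\<close> to \<open>T k i z\<close>.\<close>

lemma matrix_product_assoc:
  assumes "i \<in> S" "j \<in> S" "k \<in> S" "x \<in> carrier (R i)" "y \<in> carrier (R j)" "z \<in> carrier (R k)"
  shows "\<mu> i k l (\<mu> i j k x y) z = \<mu> i j l x (\<mu> j k l y z)"
  using assms factor_ring[of i]
  by (simp add: matrix_product_eq factor_ops transition_mult transition_closed transition_trans
      monoid.m_assoc ringE(2))

text \<open>The compatibilities of the bimodule actions and the balancing conditions are instances of
  associativity, because \<open>T i i\<close> is the identity and so the product of \<open>R i\<close> is the entry product \<open>\<mu> i i i\<close>.\<close>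

lemma pair_matrix_data: "generalized_matrix_data S M \<mu>"
proof (rule generalized_matrix_data.intro)
  fix i j assume ij: "i \<in> S" "j \<in> S"
  show "bimodule (M i i) (M j j) (M i j) (\<mu> i i j) (\<mu> i j j)"
    unfolding matrix_entry_def
  proof (intro bimodule.intro bimodule_axioms.intro)
    fix p p' x assume "p \<in> carrier (R i)" "p' \<in> carrier (R i)" "x \<in> carrier (R i)"
    with ij show "\<mu> i i j (p \<otimes>\<^bsub>R i\<^esub> p') x = \<mu> i i j p (\<mu> i i j p' x)"
      using matrix_product_assoc[of i i i p p' x j] by (simp add: matrix_product_eq transition_refl)
  next
    fix x q q' assume "x \<in> carrier (R i)" "q \<in> carrier (R j)" "q' \<in> carrier (R j)"
    with ij show "\<mu> i j j x (q \<otimes>\<^bsub>R j\<^esub> q') = \<mu> i j j (\<mu> i j j x q) q'"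
      using matrix_product_assoc[of i j j x q q' j] by (simp add: matrix_product_eq transition_refl)
  next
    fix p x q assume "p \<in> carrier (R i)" "x \<in> carrier (R i)" "q \<in> carrier (R j)"
    with ij show "\<mu> i j j (\<mu> i i j p x) q = \<mu> i i j p (\<mu> i j j x q)"
      by (simp only: matrix_product_assoc)
  qed (use ij in \<open>simp_all add: factor_ring ringE(1) matrix_product_closed matrix_product_add
      matrix_product_assoc matrix_product_eq[of _ _ "\<one>\<^bsub>R _\<^esub>"] transition_one factor_ops
      matrix_product_eq[of i i] transition_refl\<close>)
next
  fix i x y assume "i \<in> S" "x \<in> carrier (M i i)" "y \<in> carrier (M i i)"
  then show "\<mu> i i i x y = x \<otimes>\<^bsub>M i i\<^esub> y"
    by (simp add: matrix_entry_def matrix_product_eq transition_refl)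
qed (simp_all add: matrix_entry_def factor_ring matrix_product_closed matrix_product_add
    matrix_product_assoc finite_S)


section \<open>The isomorphism\<close>

abbreviation skew where "skew \<equiv> skew_groupoid_ring G A I \<phi>"
abbreviation matrices where "matrices \<equiv> generalized_matrix_ring S M \<mu>"

definition skew_of_matrix where
  "skew_of_matrix X = (\<lambda>(i, j)\<in>S \<times> S. emb j (X (j, i)))"

lemma skew_of_matrix_nth: "\<lbrakk>i \<in> S; j \<in> S\<rbrakk> \<Longrightarrow> skew_of_matrix X (i, j) = emb j (X (j, i))"
  by (simp add: skew_of_matrix_def)

lemma matrices_entry: "\<lbrakk>X \<in> carrier matrices; i \<in> S; j \<in> S\<rbrakk> \<Longrightarrow> X (i, j) \<in> carrier (R i)"
  by (auto simp: generalized_matrix_ring_def matrix_entry_def)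

lemma skew_carrier: "carrier skew = (\<Pi>\<^sub>E u\<in>S \<times> S. I u)"
proof -
  have "finite (supp G A f)" for f :: "nat \<times> nat \<Rightarrow> nat \<Rightarrow> 'a"
    by (rule finite_subset[of _ "S \<times> S"]) (auto simp: supp_def finite_S)
  then show ?thesis
    by (simp add: skew_groupoid_ring_def)
qed

lemma skew_of_matrix_bij: "bij_betw skew_of_matrix (carrier matrices) (carrier skew)"
proof (rule bij_betw_byWitness)
  let ?inv = "\<lambda>f. \<lambda>(i, j)\<in>S \<times> S. f (j, i) i"
  show "\<forall>X\<in>carrier matrices. ?inv (skew_of_matrix X) = X"
    by (auto simp: generalized_matrix_ring_def skew_of_matrix_def emb_nth PiE_iff extensional_def
        fun_eq_iff)
  show "\<forall>f\<in>carrier skew. skew_of_matrix (?inv f) = f"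
  proof
    fix f assume f: "f \<in> carrier skew"
    have "emb j (f (i, j) j) = f (i, j)" if "i \<in> S" "j \<in> S" for i j
      using f that PiE_mem[of f "S \<times> S" I "(i, j)"] by (auto simp: skew_carrier pair_ideal_eq emb_nth)
    then show "skew_of_matrix (?inv f) = f"
      using f by (auto simp: skew_carrier skew_of_matrix_def PiE_iff extensional_def fun_eq_iff)
  qed
  show "skew_of_matrix ` carrier matrices \<subseteq> carrier skew"
    by (auto simp: skew_carrier skew_of_matrix_def pair_ideal_eq matrices_entry)
  show "?inv ` carrier skew \<subseteq> carrier matrices"
  proof
    fix X assume "X \<in> ?inv ` carrier skew"
    then obtain f where f: "f \<in> carrier skew" "X = ?inv f" by auto
    have "f (j, i) i \<in> carrier (R i)" if "i \<in> S" "j \<in> S" for i j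
      using f(1) that PiE_mem[of f "S \<times> S" I "(j, i)"] by (auto simp: skew_carrier pair_ideal_eq emb_nth)
    then show "X \<in> carrier matrices"
      by (auto simp: f(2) generalized_matrix_ring_def matrix_entry_def)
  qed
qed

text \<open>The pairs of arrows with composite \<open>(k, i)\<close> are the pairs \<open>(j, i), (k, j)\<close>. The defining sum omits
  those outside the supports, and their terms vanish.\<close>

lemma skew_product_nth:
  assumes f: "f \<in> carrier skew" and g: "g \<in> carrier skew" and ki: "k \<in> S" "i \<in> S"
  shows "(f \<otimes>\<^bsub>skew\<^esub> g) (k, i) = (\<Oplus>\<^bsub>A\<^esub>j\<in>S. f (j, i) \<otimes>\<^bsub>A\<^esub> \<phi> (j, i) (g (k, j)))"
proof -
  interpret A: ring A by (rule A_ring)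
  let ?term = "\<lambda>(u, v). f u \<otimes>\<^bsub>A\<^esub> \<phi> u (g v)"
  let ?pair = "\<lambda>j. ((j, i), (k, j))"
  let ?P = "{(u, v). u \<in> supp G A f \<and> v \<in> supp G A g \<and> src G u = tgt G v \<and> cmp G u v = (k, i)}"
  have f_closed: "f u \<in> carrier A" if "u \<in> S \<times> S" for u
    using f that PiE_mem[of f "S \<times> S" I u] by (auto simp: skew_carrier pair_ideal_eq emb_closed)
  have \<phi>g_closed: "\<phi> (j, i) (g (k, j)) \<in> carrier A" if "j \<in> S" for j
    using g that ki PiE_mem[of g "S \<times> S" I "(k, j)"]
    by (auto simp: skew_carrier pair_ideal_eq pair_map_emb emb_closed transition_closed)
  have \<phi>_zero: "\<phi> (j, i) \<zero>\<^bsub>A\<^esub> = \<zero>\<^bsub>A\<^esub>" if "j \<in> S" for j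
    using that ki pair_map_emb[of j i "\<zero>\<^bsub>R j\<^esub>"] by (simp add: emb_zero transition_zero)
  have term_closed: "?term \<in> ?pair ` S \<rightarrow> carrier A"
    using f_closed \<phi>g_closed ki by auto
  have "(f \<otimes>\<^bsub>skew\<^esub> g) (k, i) = finsum A ?term ?P"
    using ki by (simp add: skew_groupoid_ring_def)
  also have "\<dots> = finsum A ?term (?pair ` S)"
  proof (rule A.add.finprod_mono_neutral_cong_left)
    show "?P \<subseteq> ?pair ` S"
      by (auto simp: supp_def)
    fix p assume p: "p \<in> ?pair ` S - ?P"
    then obtain j where j: "j \<in> S" "p = ((j, i), (k, j))" by auto
    with p ki have "f (j, i) = \<zero>\<^bsub>A\<^esub> \<or> g (k, j) = \<zero>\<^bsub>A\<^esub>"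
      by (auto simp: supp_def)
    then show "?term p = \<zero>\<^bsub>A\<^esub>"
      using j ki f_closed \<phi>g_closed \<phi>_zero by auto
  qed (use term_closed finite_S in auto)
  also have "\<dots> = (\<Oplus>\<^bsub>A\<^esub>j\<in>S. ?term (?pair j))"
    using term_closed by (intro A.finsum_reindex) (auto simp: inj_on_def)
  finally show ?thesis by simp
qed

text \<open>The terms of the two sums over \<open>j\<close> agree, because \<open>\<phi> (j, i)\<close> acts on the embedded entry
  \<open>Y (j, k)\<close> as \<open>T j i\<close>, which is the inverse of \<open>T i j\<close> used in \<open>\<mu> i j k\<close>.\<close>

lemma skew_of_matrix_mult:
  assumes X: "X \<in> carrier matrices" and Y: "Y \<in> carrier matrices"
  shows "skew_of_matrix (X \<otimes>\<^bsub>matrices\<^esub> Y) = skew_of_matrix X \<otimes>\<^bsub>skew\<^esub> skew_of_matrix Y"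
proof (rule extensionalityI)
  fix w assume "w \<in> S \<times> S"
  then obtain k i where w: "w = (k, i)" and ki: "k \<in> S" "i \<in> S" by auto
  interpret A: ring A by (rule A_ring)
  have XY: "skew_of_matrix X \<in> carrier skew" "skew_of_matrix Y \<in> carrier skew"
    using X Y bij_betw_apply[OF skew_of_matrix_bij] by auto
  have "skew_of_matrix (X \<otimes>\<^bsub>matrices\<^esub> Y) (k, i) =
      emb i (\<Oplus>\<^bsub>R i\<^esub>j\<in>S. \<mu> i j k (X (i, j)) (Y (j, k)))"
    using ki by (simp add: skew_of_matrix_nth generalized_matrix_ring_def matrix_entry_def)
  also have "\<dots> = (\<Oplus>\<^bsub>A\<^esub>j\<in>S. emb i (\<mu> i j k (X (i, j)) (Y (j, k))))"
    using ki X Y by (intro emb_finsum) (auto simp: matrix_product_closed matrices_entry)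
  also have "\<dots> = (\<Oplus>\<^bsub>A\<^esub>j\<in>S. skew_of_matrix X (j, i) \<otimes>\<^bsub>A\<^esub> \<phi> (j, i) (skew_of_matrix Y (k, j)))"
    using ki X Y
    by (intro A.finsum_cong')
      (auto simp: skew_of_matrix_nth pair_map_emb emb_mult matrices_entry transition_closed
        matrix_product_eq emb_closed factor_ops)
  also have "\<dots> = (skew_of_matrix X \<otimes>\<^bsub>skew\<^esub> skew_of_matrix Y) (k, i)"
    by (rule skew_product_nth[OF XY ki, symmetric])
  finally show "skew_of_matrix (X \<otimes>\<^bsub>matrices\<^esub> Y) w = (skew_of_matrix X \<otimes>\<^bsub>skew\<^esub> skew_of_matrix Y) w"
    by (simp add: w)
qed (simp_all add: skew_of_matrix_def skew_groupoid_ring_def)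

lemma skew_of_matrix_iso: "skew_of_matrix \<in> ring_iso matrices skew"
proof (rule ring_iso_memI)
  show "bij_betw skew_of_matrix (carrier matrices) (carrier skew)"
    by (rule skew_of_matrix_bij)
  then show "skew_of_matrix X \<in> carrier skew" if "X \<in> carrier matrices" for X
    using that by (rule bij_betw_apply)
  show "skew_of_matrix \<one>\<^bsub>matrices\<^esub> = \<one>\<^bsub>skew\<^esub>"
    by (auto simp: skew_of_matrix_def generalized_matrix_ring_def skew_groupoid_ring_def
        matrix_entry_def objects_pair_groupoid pair_ideal_eq factor_unit emb_zero
        intro!: restrict_ext)
  fix X Y assume XY: "X \<in> carrier matrices" "Y \<in> carrier matrices"
  then show "skew_of_matrix (X \<otimes>\<^bsub>matrices\<^esub> Y) = skew_of_matrix X \<otimes>\<^bsub>skew\<^esub> skew_of_matrix Y"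
    by (rule skew_of_matrix_mult)
  have "emb i (X (i, k) \<oplus>\<^bsub>R i\<^esub> Y (i, k)) = emb i (X (i, k)) \<oplus>\<^bsub>A\<^esub> emb i (Y (i, k))"
    if "i \<in> S" "k \<in> S" for i k
    using that XY by (simp add: emb_add matrices_entry)
  then show "skew_of_matrix (X \<oplus>\<^bsub>matrices\<^esub> Y) = skew_of_matrix X \<oplus>\<^bsub>skew\<^esub> skew_of_matrix Y"
    by (auto simp: skew_of_matrix_def generalized_matrix_ring_def skew_groupoid_ring_def
        matrix_entry_def intro!: restrict_ext)
qed

lemma matrices_ring: "ring matrices"
  by (rule generalized_matrix_data.matrices_ring) (rule pair_matrix_data)

text \<open>A ring isomorphism in the sense of \<open>ring_iso\<close> is not required to match the zero fields of the
  two records, so the transport of the ring axioms needs this compared separately.\<close>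

lemma skew_ring: "ring skew"
proof -
  have "skew_of_matrix \<zero>\<^bsub>matrices\<^esub> = \<zero>\<^bsub>skew\<^esub>"
    by (auto simp: skew_of_matrix_def generalized_matrix_ring_def skew_groupoid_ring_def
        matrix_entry_def emb_zero intro!: restrict_ext)
  then show ?thesis
    using ring.ring_iso_imp_img_ring[OF matrices_ring skew_of_matrix_iso] by simp
qed

end

theorem proposition3p3:
  fixes n :: nat
    and R :: "nat \<Rightarrow> ('a, 'm) ring_scheme"
    and \<theta> :: "nat \<Rightarrow> 'a \<Rightarrow> 'a"
  assumes "n \<ge> 1"
    and "\<And>i. i \<in> {1..n} \<Longrightarrow> ring (R i)"
    and "\<And>i. i \<in> {1..n} \<Longrightarrow> \<theta> i \<in> ring_iso (R 1) (R i)"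
  defines "G \<equiv> pair_groupoid {1..n}"
    and "A \<equiv> product_ring {1..n} R"
    and "I \<equiv> pair_ideal {1..n} R"
    and "\<phi> \<equiv> pair_map {1..n} R \<theta>"
    and "M \<equiv> matrix_entry R"
    and "\<mu> \<equiv> matrix_product R \<theta>"
  shows "groupoid_action G A I \<phi> \<and>
    generalized_matrix_data {1..n} M \<mu> \<and>
    ring (skew_groupoid_ring G A I \<phi>) \<and>
    ring (generalized_matrix_ring {1..n} M \<mu>) \<and>
    skew_groupoid_ring G A I \<phi> \<simeq> generalized_matrix_ring {1..n} M \<mu>"
proof -
  interpret isomorphic_rings "{1..n}" R \<theta>
    by (intro isomorphic_rings.intro ring_family.intro isomorphic_rings_axioms.intro)
      (use assms(1-3) in simp_all)
  have "skew \<simeq> matrices"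
    using ring_iso_set_sym[OF matrices_ring skew_of_matrix_iso] by (auto simp: is_ring_iso_def)
  then show ?thesis
    unfolding assms(4-9)
    using pair_action pair_matrix_data skew_ring matrices_ring by blast
qed

end
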